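(* Let $\mathcal R$ be a division ring and let $v_1,v_2,v_3,v_4,v_5\in\mathcal R^2$ be five pairwise linearly independent vectors (in the right vector space $\mathcal R^2$). Put $$x_1=-\kappa(1,2,3,4),\quad x_2=-\kappa(5,2,3,1),\quad x_3=-\kappa(5,4,2,1),\quad x_4=-\kappa(3,4,2,5),\quad x_5=-\kappa(3,1,4,5),$$ $$x_6=\overline{x_1}=-\kappa(2,1,4,3),\qquad x_7=\overline{x_2}=-\kappa(2,5,1,3).$$ Then $$x_1\,q^1_{32}\,x_3\,q^1_{23}=1+x_2,\qquad x_4\,q^5_{23}\,x_2\,q^5_{32}=1+x_3,$$ $$x_3\,q^5_{24}\,x_5\,q^5_{42}=1+x_4,\qquad x_6\,q^3_{42}\,x_4\,q^3_{24}=1+x_5,$$ $$x_5\,q^3_{41}\,x_7\,q^3_{14}=1+x_6 .$$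
   Context: Vectors in $\mathcal R^2$ are columns, $v_i=(a_{1i},a_{2i})^T$, and scalars act on the right. For indices $i\ne k$ with $v_i,v_k$ linearly independent and any $j$, the quasi-Pl\"ucker coordinate $q^k_{ij}$ is $$q_{ij}^k=(a_{1i}-a_{1k}a_{2k}^{-1}a_{2i})^{-1}(a_{1j}-a_{1k}a_{2k}^{-1}a_{2j})\quad\text{if }a_{2k}\neq0,$$ $$q_{ij}^k=(a_{2i}-a_{2k}a_{1k}^{-1}a_{1i})^{-1}(a_{2j}-a_{2k}a_{1k}^{-1}a_{1j})\quad\text{if }a_{1k}\ne 0;$$ the two expressions agree when both are defined. The noncommutative cross-ratio of four vectors with indices $i,j,k,l$ is $$\kappa(i,j,k,l)=q^j_{kl}\,q^i_{lk}.$$ The bar operation is $\overline{\kappa(i,j,k,l)}=\kappa(j,i,l,k)$, extended by $\overline{-\kappa}=-\overline{\kappa}$. *)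

theory Defs
  imports "HOL-Analysis.Analysis"
begin

text \<open>
  The library's notions of module and linear independence require commutative scalars, so
  the right action of a division ring on columns and right linear independence of two
  vectors are introduced here.
\<close>

definition right_scale :: "'a::division_ring ^ 'n \<Rightarrow> 'a \<Rightarrow> 'a ^ 'n" where
  "right_scale v s = (\<chi> m. v $ m * s)"

definition right_independent :: "'a::division_ring ^ 'n \<Rightarrow> 'a ^ 'n \<Rightarrow> bool" where
  "right_independent v w \<longleftrightarrow>
     (\<forall>s t. right_scale v s + right_scale w t = 0 \<longrightarrow> s = 0 \<and> t = 0)"

text \<open>
  \<open>quasi_plucker v k i j\<close> is the coordinate written with upper index \<open>k\<close> and lower
  indices \<open>i\<close>, \<open>j\<close>; the entry \<open>v i $ m\<close> is the matrix entry in row \<open>m\<close> and column \<open>i\<close>.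
  The two branches agree when both are defined (see \<open>quasi_plucker_alt\<close> below).
  The value is meaningful only if \<open>v i\<close> and \<open>v k\<close> are right linearly independent.
\<close>

definition quasi_plucker :: "(nat \<Rightarrow> 'a::division_ring ^ 2) \<Rightarrow> nat \<Rightarrow> nat \<Rightarrow> nat \<Rightarrow> 'a" where
  "quasi_plucker v k i j =
     (if v k $ 2 \<noteq> 0
      then inverse (v i $ 1 - v k $ 1 * inverse (v k $ 2) * v i $ 2) *
             (v j $ 1 - v k $ 1 * inverse (v k $ 2) * v j $ 2)
      else inverse (v i $ 2 - v k $ 2 * inverse (v k $ 1) * v i $ 1) *
             (v j $ 2 - v k $ 2 * inverse (v k $ 1) * v j $ 1))"

lemma quasi_plucker_alt:
  fixes v :: "nat \<Rightarrow> 'a::division_ring ^ 2"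
  assumes "v k $ 1 \<noteq> 0"
  shows "quasi_plucker v k i j =
           inverse (v i $ 2 - v k $ 2 * inverse (v k $ 1) * v i $ 1) *
             (v j $ 2 - v k $ 2 * inverse (v k $ 1) * v j $ 1)"
proof (cases "v k $ 2 = 0")
  case True
  then show ?thesis by (simp add: quasi_plucker_def)
next
  case False
  define c where "c = v k $ 1 * inverse (v k $ 2)"
  define f where "f m = v m $ 2 - inverse c * v m $ 1" for m
  have c: "c \<noteq> 0" using assms False by (simp add: c_def)
  have ic: "v k $ 2 * inverse (v k $ 1) = inverse c"
    using assms False by (simp add: c_def nonzero_inverse_mult_distrib)
  have cancel: "c * (inverse c * x) = x" "inverse c * (c * x) = x" for x
    using c by (simp_all add: mult.assoc [symmetric])
  have f: "v m $ 1 - c * v m $ 2 = - (c * f m)" for m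
    by (simp add: f_def right_diff_distrib cancel)
  have "quasi_plucker v k i j = inverse (- (c * f i)) * (- (c * f j))"
    using False by (simp only: quasi_plucker_def c_def [symmetric] f) simp
  also have "\<dots> = inverse (f i) * f j"
    using c by (cases "f i = 0") (simp_all add: nonzero_inverse_mult_distrib mult.assoc cancel)
  finally show ?thesis by (simp add: f_def ic)
qed

definition cross_ratio :: "(nat \<Rightarrow> 'a::division_ring ^ 2) \<Rightarrow> nat \<Rightarrow> nat \<Rightarrow> nat \<Rightarrow> nat \<Rightarrow> 'a" where
  "cross_ratio v i j k l = quasi_plucker v j k l * quasi_plucker v i l k"

text \<open>
  The bar operation acts on the indexed expression \<open>cross_ratio v i j k l\<close> and not on its
  value in the division ring, so it is a function of the indices. Its extension to
  negatives is then written \<open>- cross_ratio_bar v i j k l\<close>.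
\<close>

definition cross_ratio_bar :: "(nat \<Rightarrow> 'a::division_ring ^ 2) \<Rightarrow> nat \<Rightarrow> nat \<Rightarrow> nat \<Rightarrow> nat \<Rightarrow> 'a" where
  "cross_ratio_bar v i j k l = cross_ratio v j i l k"

end

theory Submission
  imports Defs
begin

text \<open>
  \<open>v k\<close> is annihilated by a right linear form \<open>h\<^sub>k\<close>, and the quasi-Pluecker coordinate with indices
  \<open>k; i, j\<close> is the quotient \<open>h\<^sub>k(v i)\<inverse> h\<^sub>k(v j)\<close>. It is also the coefficient of \<open>v i\<close> when \<open>v j\<close> is
  expanded in the basis \<open>v i, v k\<close>; applying a third form \<open>h\<^sub>a\<close> to this expansion gives the Pluecker
  relation, whose case \<open>a = j\<close> is skew-symmetry. In each of the five identities skew-symmetry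
  collapses the left-hand side to three factors, and one Pluecker relation finishes.
\<close>

text \<open>The form killing \<open>u\<close> is unique only up to a left factor, which cancels in
  \<open>quasi_plucker\<close>. The case split copies the one there, so the quotient formula is pure
  unfolding.\<close>

definition annihilator_form :: "'a::division_ring ^ 2 \<Rightarrow> 'a ^ 2 \<Rightarrow> 'a" where
  "annihilator_form u w =
     (if u $ 2 \<noteq> 0 then w $ 1 - u $ 1 * inverse (u $ 2) * w $ 2
      else w $ 2 - u $ 2 * inverse (u $ 1) * w $ 1)"

lemma quasi_plucker_eq_annihilator_form:
  "quasi_plucker v k i j =
     inverse (annihilator_form (v k) (v i)) * annihilator_form (v k) (v j)"
  by (simp add: quasi_plucker_def annihilator_form_def)

lemma annihilator_form_add:
  "annihilator_form u (w + z) = annihilator_form u w + annihilator_form u z"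
  by (simp add: annihilator_form_def algebra_simps)

lemma annihilator_form_right_scale:
  "annihilator_form u (right_scale w s) = annihilator_form u w * s"
  by (simp add: annihilator_form_def right_scale_def algebra_simps mult.assoc)

lemma annihilator_form_self: "annihilator_form u u = 0"
  by (simp add: annihilator_form_def mult.assoc)

text \<open>The kernel of the form is the line spanned by \<open>u\<close>; the scalar
  \<open>t\<close> is read off from a coordinate in which \<open>u\<close> does not vanish. For
  \<open>u = 0\<close> the form degenerates to the second coordinate.\<close>

lemma annihilator_form_eq_0E:
  fixes u w :: "'a::division_ring ^ 2"
  assumes "annihilator_form u w = 0" and "u \<noteq> 0"
  obtains t where "w = right_scale u t"
proof (cases "u $ 2 = 0")
  case True
  then have u1: "u $ 1 \<noteq> 0"
    using assms(2) by (auto simp: vec_eq_iff forall_2)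
  have "w = right_scale u (inverse (u $ 1) * w $ 1)"
    using assms(1) True u1
    by (simp add: annihilator_form_def right_scale_def vec_eq_iff forall_2 mult.assoc [symmetric])
  then show ?thesis by (rule that)
next
  case False
  have "w = right_scale u (inverse (u $ 2) * w $ 2)"
    using assms(1) False
    by (simp add: annihilator_form_def right_scale_def vec_eq_iff forall_2 mult.assoc [symmetric])
  then show ?thesis by (rule that)
qed

lemma right_independent_commute: "right_independent u w \<longleftrightarrow> right_independent w u"
  unfolding right_independent_def by (metis add.commute)

lemma right_independent_nonzero:
  assumes "right_independent u w"
  shows "u \<noteq> 0"
proof
  assume "u = 0"
  then have "right_scale u 1 + right_scale w 0 = 0"
    by (simp add: right_scale_def vec_eq_iff)
  then show False
    using assms unfolding right_independent_def by (metis zero_neq_one)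
qed

lemma annihilator_form_nonzero:
  assumes "right_independent u w"
  shows "annihilator_form u w \<noteq> 0"
proof
  assume "annihilator_form u w = 0"
  then obtain t where "w = right_scale u t"
    using right_independent_nonzero [OF assms] by (rule annihilator_form_eq_0E)
  then have "right_scale u t + right_scale w (- 1) = 0"
    by (simp add: right_scale_def vec_eq_iff)
  then show False
    using assms unfolding right_independent_def by (metis neg_equal_0_iff_equal zero_neq_one)
qed

lemma quasi_plucker_expansion:
  fixes v :: "nat \<Rightarrow> 'a::division_ring ^ 2"
  assumes "right_independent (v i) (v k)"
  shows "v j = right_scale (v i) (quasi_plucker v k i j) + right_scale (v k) (quasi_plucker v i k j)"
proof -
  define s where "s = quasi_plucker v k i j"
  have ki: "annihilator_form (v k) (v i) \<noteq> 0" and ik: "annihilator_form (v i) (v k) \<noteq> 0"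
    using assms by (auto simp: annihilator_form_nonzero right_independent_commute)
  have "v k \<noteq> 0"
    using assms right_independent_commute right_independent_nonzero by blast
  \<comment> \<open>Since \<open>s\<close> is the quotient of the values at \<open>v j\<close> and
    \<open>v i\<close>, the form of \<open>v k\<close> kills this difference, which therefore lies
    on the line of \<open>v k\<close>.\<close>
  moreover have "annihilator_form (v k) (v j + right_scale (v i) (- s)) = 0"
    using ki
    by (simp add: s_def annihilator_form_add annihilator_form_right_scale
        quasi_plucker_eq_annihilator_form mult.assoc [symmetric])
  ultimately obtain t where t: "v j + right_scale (v i) (- s) = right_scale (v k) t"
    using annihilator_form_eq_0E by metis
  then have vj: "v j = right_scale (v i) s + right_scale (v k) t"
    by (simp add: vec_eq_iff right_scale_def algebra_simps)
  \<comment> \<open>The form of \<open>v i\<close> kills the first summand and so isolates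
    \<open>t\<close>.\<close>
  then have "annihilator_form (v i) (v j) = annihilator_form (v i) (v k) * t"
    by (metis annihilator_form_add annihilator_form_right_scale annihilator_form_self
        add_0 mult_zero_left)
  then have "t = quasi_plucker v i k j"
    using ik by (simp add: quasi_plucker_eq_annihilator_form mult.assoc [symmetric])
  then show ?thesis
    using vj by (simp add: s_def)
qed

lemma quasi_plucker_relation:
  fixes v :: "nat \<Rightarrow> 'a::division_ring ^ 2"
  assumes "right_independent (v i) (v k)" and "right_independent (v a) (v i)"
  shows "quasi_plucker v a i j =
           quasi_plucker v k i j + quasi_plucker v a i k * quasi_plucker v i k j"
proof -
  have "annihilator_form (v a) (v j) =
      annihilator_form (v a) (v i) * quasi_plucker v k i j +
      annihilator_form (v a) (v k) * quasi_plucker v i k j"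
    using quasi_plucker_expansion [OF assms(1), of j]
    by (metis annihilator_form_add annihilator_form_right_scale)
  then have "quasi_plucker v a i j = inverse (annihilator_form (v a) (v i)) *
      (annihilator_form (v a) (v i) * quasi_plucker v k i j +
       annihilator_form (v a) (v k) * quasi_plucker v i k j)"
    by (simp only: quasi_plucker_eq_annihilator_form [of v a i j])
  also have "\<dots> = quasi_plucker v k i j + quasi_plucker v a i k * quasi_plucker v i k j"
    using annihilator_form_nonzero [OF assms(2)]
    by (simp add: quasi_plucker_eq_annihilator_form [of v a i k] distrib_left mult.assoc [symmetric])
  finally show ?thesis .
qed

text \<open>Both factors are quotients of values of the same form, so the inner value at
  \<open>v j\<close> cancels.\<close>

lemma quasi_plucker_mult_same:
  assumes "right_independent (v k) (v j)"
  shows "quasi_plucker v k i j * quasi_plucker v k j l = quasi_plucker v k i l"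
proof -
  have "annihilator_form (v k) (v j) * (inverse (annihilator_form (v k) (v j)) * x) = x" for x
    using annihilator_form_nonzero [OF assms] by (simp add: mult.assoc [symmetric])
  then show ?thesis
    by (simp add: quasi_plucker_eq_annihilator_form mult.assoc)
qed

lemma quasi_plucker_inverse:
  assumes "right_independent (v k) (v i)" and "right_independent (v k) (v j)"
  shows "quasi_plucker v k i j * quasi_plucker v k j i = 1"
  using annihilator_form_nonzero [OF assms(1)] quasi_plucker_mult_same [OF assms(2), of i i]
  by (simp add: quasi_plucker_eq_annihilator_form)

lemma quasi_plucker_skew:
  fixes v :: "nat \<Rightarrow> 'a::division_ring ^ 2"
  assumes "right_independent (v i) (v k)" and "right_independent (v i) (v j)"
  shows "quasi_plucker v k i j * quasi_plucker v i j k = - quasi_plucker v j i k"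
proof -
  have "quasi_plucker v j i j = 0"
    by (simp add: quasi_plucker_eq_annihilator_form annihilator_form_self)
  then have "quasi_plucker v k i j = - (quasi_plucker v j i k * quasi_plucker v i k j)"
    using quasi_plucker_relation [OF assms(1), of j j] assms(2)
    by (simp add: right_independent_commute eq_neg_iff_add_eq_0)
  \<comment> \<open>Multiplying on the right by \<open>quasi_plucker v i j k\<close> cancels its
    inverse \<open>quasi_plucker v i k j\<close>.\<close>
  then show ?thesis
    by (simp add: mult.assoc quasi_plucker_inverse assms)
qed

text \<open>Common form of the first, third and fifth identities. The minus signs of the two
  variables on the left cancel; the one on the right gives
  \<open>1 - cross_ratio v e b c a\<close>.\<close>

lemma cross_ratio_exchange:
  fixes v :: "nat \<Rightarrow> 'a::division_ring ^ 2"
  assumes indep: "pairwise (\<lambda>i j. right_independent (v i) (v j)) {a, b, c, d, e}"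
    and dist: "distinct [a, b, c, d, e]"
  shows "cross_ratio v a b c d * quasi_plucker v a c b * cross_ratio v e d b a *
           quasi_plucker v a b c = 1 - cross_ratio v e b c a"
proof -
  note ind = pairwiseD [OF indep]
  let ?q = "quasi_plucker v"
  have "cross_ratio v a b c d * ?q a c b * cross_ratio v e d b a * ?q a b c =
      ?q b c d * ((?q a d c * ?q a c b) * ?q d b a) * ?q e a b * ?q a b c"
    by (simp add: cross_ratio_def mult.assoc)
  also have "?q a d c * ?q a c b = ?q a d b"
    by (rule quasi_plucker_mult_same) (use dist in \<open>auto intro: ind\<close>)
  also have "?q a d b * ?q d b a = - ?q b d a"
    by (rule quasi_plucker_skew) (use dist in \<open>auto intro: ind\<close>)
  also have "?q b c d * - ?q b d a = - ?q b c a"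
    by (subst mult_minus_right, subst quasi_plucker_mult_same) (use dist in \<open>auto intro: ind\<close>)
  also have "- ?q b c a * ?q e a b * ?q a b c = - (?q b c a * (?q e a b * ?q a b c))"
    by (simp add: mult.assoc)
  \<comment> \<open>The relation is used solved for its product term: one summand of the difference
    produces the cross-ratio, the other the constant 1.\<close>
  also have "?q e a b * ?q a b c = ?q e a c - ?q b a c"
    by (subst quasi_plucker_relation [of v a b e c]) (use dist in \<open>auto intro: ind\<close>)
  also have "- (?q b c a * (?q e a c - ?q b a c)) = ?q b c a * ?q b a c - ?q b c a * ?q e a c"
    by (simp add: right_diff_distrib)
  also have "?q b c a * ?q b a c = 1"
    by (rule quasi_plucker_inverse) (use dist in \<open>auto intro: ind\<close>)
  finally show ?thesis
    by (simp add: cross_ratio_def)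
qed

text \<open>Common form of the second and fourth identities. Here the relation splits the left
  factor of the collapsed product, not the right one.\<close>

lemma cross_ratio_exchange':
  fixes v :: "nat \<Rightarrow> 'a::division_ring ^ 2"
  assumes indep: "pairwise (\<lambda>i j. right_independent (v i) (v j)) {a, b, c, d, e}"
    and dist: "distinct [a, b, c, d, e]"
  shows "cross_ratio v c d b e * quasi_plucker v e b c * cross_ratio v e b c a *
           quasi_plucker v e c b = 1 - cross_ratio v e d b a"
proof -
  note ind = pairwiseD [OF indep]
  let ?q = "quasi_plucker v"
  have "cross_ratio v c d b e * ?q e b c * cross_ratio v e b c a * ?q e c b =
      ?q d b e * ((?q c e b * ?q e b c) * ?q b c a) * (?q e a c * ?q e c b)"
    by (simp add: cross_ratio_def mult.assoc)
  also have "?q e a c * ?q e c b = ?q e a b"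
    by (rule quasi_plucker_mult_same) (use dist in \<open>auto intro: ind\<close>)
  also have "?q c e b * ?q e b c = - ?q b e c"
    by (rule quasi_plucker_skew) (use dist in \<open>auto intro: ind\<close>)
  also have "- ?q b e c * ?q b c a = - ?q b e a"
    by (subst mult_minus_left, subst quasi_plucker_mult_same) (use dist in \<open>auto intro: ind\<close>)
  also have "?q d b e * - ?q b e a * ?q e a b = - ((?q d b e * ?q b e a) * ?q e a b)"
    by simp
  also have "?q d b e * ?q b e a = ?q d b a - ?q e b a"
    by (subst quasi_plucker_relation [of v b e d a]) (use dist in \<open>auto intro: ind\<close>)
  also have "- ((?q d b a - ?q e b a) * ?q e a b) = ?q e b a * ?q e a b - ?q d b a * ?q e a b"
    by (simp add: left_diff_distrib)
  also have "?q e b a * ?q e a b = 1"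
    by (rule quasi_plucker_inverse) (use dist in \<open>auto intro: ind\<close>)
  finally show ?thesis
    by (simp add: cross_ratio_def)
qed

theorem mainTheorem1:
  fixes v :: "nat \<Rightarrow> 'a::division_ring ^ 2"
    and x1 x2 x3 x4 x5 x6 x7 :: 'a
  assumes "pairwise (\<lambda>i j. right_independent (v i) (v j)) {1..5}"
    and "x1 = - cross_ratio v 1 2 3 4"
    and "x2 = - cross_ratio v 5 2 3 1"
    and "x3 = - cross_ratio v 5 4 2 1"
    and "x4 = - cross_ratio v 3 4 2 5"
    and "x5 = - cross_ratio v 3 1 4 5"
    and "x6 = - cross_ratio_bar v 1 2 3 4"
    and "x7 = - cross_ratio_bar v 5 2 3 1"
  shows "x6 = - cross_ratio v 2 1 4 3
    \<and> x7 = - cross_ratio v 2 5 1 3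
    \<and> x1 * quasi_plucker v 1 3 2 * x3 * quasi_plucker v 1 2 3 = 1 + x2
    \<and> x4 * quasi_plucker v 5 2 3 * x2 * quasi_plucker v 5 3 2 = 1 + x3
    \<and> x3 * quasi_plucker v 5 2 4 * x5 * quasi_plucker v 5 4 2 = 1 + x4
    \<and> x6 * quasi_plucker v 3 4 2 * x4 * quasi_plucker v 3 2 4 = 1 + x5
    \<and> x5 * quasi_plucker v 3 4 1 * x7 * quasi_plucker v 3 1 4 = 1 + x6"
proof -
  have indep: "pairwise (\<lambda>i j. right_independent (v i) (v j)) {a, b, c, d, e}"
    if "{a, b, c, d, e} \<subseteq> {1..5}" for a b c d e :: nat
    using assms(1) that by (rule pairwise_subset)
  show ?thesis
    \<comment> \<open>The tuple \<open>5 4 2 1 3\<close> is a permutation of the indices that turns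
      the first two identities into the third and fourth; its square \<open>3 1 4 5 2\<close> turns
      the first into the fifth.\<close>
    using cross_ratio_exchange [OF indep, of 1 2 3 4 5]
      cross_ratio_exchange' [OF indep, of 1 2 3 4 5]
      cross_ratio_exchange [OF indep, of 5 4 2 1 3]
      cross_ratio_exchange' [OF indep, of 5 4 2 1 3]
      cross_ratio_exchange [OF indep, of 3 1 4 5 2]
    by (simp add: assms(2-) cross_ratio_bar_def)
qed

end
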